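(* Suppose that $x$, $\alpha_H$, $1-\alpha$ and $\nu$ are fixed. With the estimators $\widehat\sigma_\varepsilon,\widehat\nu$ defined in the context, the conditional coverage probability $P(b\in K(\widehat\sigma_\varepsilon,\widehat\nu)\mid x)$ of the confidence interval constructed after the Hausman pretest is an even function of $\gamma=\xi N^{1/2}/\sigma_\varepsilon$.
   Context: Model. Let $N\ge 3$, $T\ge 2$, and let $x=(x_{11},\dots,x_{1T},\dots,x_{N1},\dots,x_{NT})$ be given real numbers; all probabilities are conditional on $x$, i.e. $x$ is treated as fixed. For $i=1,\dots,N$, $t=1,\dots,T$, $$y_{it}=a+b\,x_{it}+\xi\,\overline{x}_i+\eta_i+\varepsilon_{it},\qquad \overline{x}_i=T^{-1}\sum_{t=1}^T x_{it},$$ where $a,b,\xi\in\mathbb{R}$ are unknown, the $\eta_i$ and $\varepsilon_{it}$ are all independent, $\eta_i\sim N(0,\sigma_\eta^2)$, $\varepsilon_{it}\sim N(0,\sigma_\varepsilon^2)$, $\sigma_\eta,\sigma_\varepsilon>0$. Put $\nu=\sigma_\eta^2/\sigma_\varepsilon^2\in(0,\infty)$ and $\gamma=\xi N^{1/2}/\sigma_\varepsilon$. Overbars with index $i$ denote averages over $t$ (e.g. $\overline{y}_i$), and overbars without index denote averages of these over $i$ (e.g. $\overline{x}=N^{-1}\sum_i\overline{x}_i$). Let $SSB=\sum_{i}(\overline{x}_i-\overline{x})^2$, $SSW=\sum_{i}\sum_{t}(x_{it}-\overline{x}_i)^2$, both assumed positive, $r(x)=SSB/SSW$, and $q(n,T)=n+T^{-1}$.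 Estimators of slopes. $\widetilde b_W=\sum_i\sum_t(x_{it}-\overline{x}_i)(y_{it}-\overline{y}_i)/SSW$ and $\widetilde b_B=\sum_i(\overline{x}_i-\overline{x})(\overline{y}_i-\overline{y})/SSB$, with $\mathrm{Var}(\widetilde b_W\mid x)=\sigma_\varepsilon^2/SSW$ and $\mathrm{Var}(\widetilde b_B\mid x)=\sigma_\varepsilon^2 q(\nu,T)/SSB$. The estimator $\widehat b$ is the GLS estimator of $b$ in the model with $\xi=0$; explicitly $\widehat b=w\widetilde b_W+(1-w)\widetilde b_B$ with $w=q(\nu,T)/(q(\nu,T)+r(x))$, and $\mathrm{Var}(\widehat b\mid x)=\sigma_\varepsilon^2 w/SSW$. Estimators of variances. With $r_{it}=(y_{it}-\overline{y}_i)-\widetilde b_W(x_{it}-\overline{x}_i)$, $\widehat\sigma_\varepsilon^2=\frac{1}{N(T-1)}\sum_i\sum_t r_{it}^2$. With $\widetilde a=\overline{y}-\widetilde b_B\overline{x}$ and $\widetilde r_i=\overline{y}_i-(\widetilde a+\widetilde b_B\overline{x}_i)$, $\widehat\sigma_\eta^2=N^{-1}\sum_i\widetilde r_i^2-T^{-1}\widehat\sigma_\varepsilon^2$. Finally $\widehat\nu=\widehat\sigma_\eta^2/\widehat\sigma_\varepsilon^2$. Two-stage interval. Let $\alpha,\alpha_H\in(0,1)$ and $z_c=\Phi^{-1}(c)$, $\Phi$ the $N(0,1)$ cdf. Define $I(\sigma_\varepsilon,\nu)=[\widehat b\pm z_{1-\alpha/2}\mathrm{Var}(\widehat b\mid x)^{1/2}]$,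 $J(\sigma_\varepsilon)=[\widetilde b_W\pm z_{1-\alpha/2}\mathrm{Var}(\widetilde b_W\mid x)^{1/2}]$ and the Hausman statistic $H(\sigma_\varepsilon,\nu)=(\widetilde b_W-\widetilde b_B)^2/(\mathrm{Var}(\widetilde b_W\mid x)+\mathrm{Var}(\widetilde b_B\mid x))$. $K(\sigma_\varepsilon,\nu)$ equals $I(\sigma_\varepsilon,\nu)$ if $H(\sigma_\varepsilon,\nu)\le z_{1-\alpha_H/2}^2$ and equals $J(\sigma_\varepsilon)$ otherwise. $I(\widehat\sigma_\varepsilon,\widehat\nu)$, $J(\widehat\sigma_\varepsilon)$, $H(\widehat\sigma_\varepsilon,\widehat\nu)$, $K(\widehat\sigma_\varepsilon,\widehat\nu)$ are obtained by replacing $\sigma_\varepsilon,\nu$ everywhere in these definitions (including in the weight $w$ in $\widehat b$ and in the variance formulas) by $\widehat\sigma_\varepsilon,\widehat\nu$. For fixed $x,\alpha,\alpha_H$, the probability $P(b\in K(\widehat\sigma_\varepsilon,\widehat\nu)\mid x)$ depends on the model parameters $(a,b,\xi,\sigma_\varepsilon,\sigma_\eta)$ only through $(\gamma,\nu)$, so it may be regarded as a function of $(\gamma,\nu)$. *)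

theory Defs
  imports "HOL-Probability.Probability"
begin

text \<open>
  Panel data are functions of type \<^typ>\<open>nat \<Rightarrow> nat \<Rightarrow> real\<close>, of which only the entries with
  \<open>i \<in> {1..N}\<close> (individual) and \<open>t \<in> {1..T}\<close> (time) matter.
\<close>

definition time_mean :: "nat \<Rightarrow> (nat \<Rightarrow> nat \<Rightarrow> real) \<Rightarrow> nat \<Rightarrow> real" where
  "time_mean T z i = (\<Sum>t\<in>{1..T}. z i t) / real T"

definition grand_mean :: "nat \<Rightarrow> nat \<Rightarrow> (nat \<Rightarrow> nat \<Rightarrow> real) \<Rightarrow> real" where
  "grand_mean N T z = (\<Sum>i\<in>{1..N}. time_mean T z i) / real N"

definition SSB :: "nat \<Rightarrow> nat \<Rightarrow> (nat \<Rightarrow> nat \<Rightarrow> real) \<Rightarrow> real" where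
  "SSB N T x = (\<Sum>i\<in>{1..N}. (time_mean T x i - grand_mean N T x)\<^sup>2)"

definition SSW :: "nat \<Rightarrow> nat \<Rightarrow> (nat \<Rightarrow> nat \<Rightarrow> real) \<Rightarrow> real" where
  "SSW N T x = (\<Sum>i\<in>{1..N}. \<Sum>t\<in>{1..T}. (x i t - time_mean T x i)\<^sup>2)"

definition ss_ratio :: "nat \<Rightarrow> nat \<Rightarrow> (nat \<Rightarrow> nat \<Rightarrow> real) \<Rightarrow> real" where
  "ss_ratio N T x = SSB N T x / SSW N T x"

definition qf :: "real \<Rightarrow> nat \<Rightarrow> real" where
  "qf n T = n + 1 / real T"

text \<open>
  The random effects model given \<open>x\<close>. All \<open>\<eta>\<^sub>i\<close> and \<open>\<epsilon>\<^sub>i\<^sub>t\<close> form one jointly independent family,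
  indexed by a disjoint sum. The second argument of \<^const>\<open>normal_density\<close> is the standard
  deviation.
\<close>

locale random_effects_panel = prob_space M
  for M :: "'w measure" +
  fixes N T :: nat
    and x :: "nat \<Rightarrow> nat \<Rightarrow> real"
    and a b \<xi> \<sigma>\<^sub>\<epsilon> \<sigma>\<^sub>\<eta> :: real
    and \<eta> :: "nat \<Rightarrow> 'w \<Rightarrow> real"
    and \<epsilon> y :: "nat \<Rightarrow> nat \<Rightarrow> 'w \<Rightarrow> real"
  assumes sigma_eps_pos: "\<sigma>\<^sub>\<epsilon> > 0"
    and sigma_eta_pos: "\<sigma>\<^sub>\<eta> > 0"
    and indep: "indep_vars (\<lambda>_. borel) (case_sum \<eta> (\<lambda>(i, t). \<epsilon> i t))
                  ({1..N} <+> {1..N} \<times> {1..T})"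
    and eta_distr: "\<And>i. i \<in> {1..N} \<Longrightarrow> distributed M lborel (\<eta> i) (normal_density 0 \<sigma>\<^sub>\<eta>)"
    and eps_distr: "\<And>i t. i \<in> {1..N} \<Longrightarrow> t \<in> {1..T} \<Longrightarrow>
                      distributed M lborel (\<epsilon> i t) (normal_density 0 \<sigma>\<^sub>\<epsilon>)"
    and response: "\<And>i t \<omega>. i \<in> {1..N} \<Longrightarrow> t \<in> {1..T} \<Longrightarrow> \<omega> \<in> space M \<Longrightarrow>
                     y i t \<omega> = a + b * x i t + \<xi> * time_mean T x i + \<eta> i \<omega> + \<epsilon> i t \<omega>"

text \<open>
  Below, \<open>y\<close> is an observed data set, and \<open>\<sigma>\<close>, \<open>\<nu>\<close> are the values used for the standard deviation
  of \<open>\<epsilon>\<^sub>i\<^sub>t\<close> and for the variance ratio: either the true values or estimates.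
\<close>

definition b_within ::
  "nat \<Rightarrow> nat \<Rightarrow> (nat \<Rightarrow> nat \<Rightarrow> real) \<Rightarrow> (nat \<Rightarrow> nat \<Rightarrow> real) \<Rightarrow> real" where
  "b_within N T x y =
     (\<Sum>i\<in>{1..N}. \<Sum>t\<in>{1..T}. (x i t - time_mean T x i) * (y i t - time_mean T y i)) / SSW N T x"

definition b_between ::
  "nat \<Rightarrow> nat \<Rightarrow> (nat \<Rightarrow> nat \<Rightarrow> real) \<Rightarrow> (nat \<Rightarrow> nat \<Rightarrow> real) \<Rightarrow> real" where
  "b_between N T x y =
     (\<Sum>i\<in>{1..N}. (time_mean T x i - grand_mean N T x) * (time_mean T y i - grand_mean N T y))
       / SSB N T x"

definition gls_weight :: "nat \<Rightarrow> nat \<Rightarrow> (nat \<Rightarrow> nat \<Rightarrow> real) \<Rightarrow> real \<Rightarrow> real" where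
  "gls_weight N T x \<nu> = qf \<nu> T / (qf \<nu> T + ss_ratio N T x)"

definition b_gls ::
  "nat \<Rightarrow> nat \<Rightarrow> (nat \<Rightarrow> nat \<Rightarrow> real) \<Rightarrow> (nat \<Rightarrow> nat \<Rightarrow> real) \<Rightarrow> real \<Rightarrow> real" where
  "b_gls N T x y \<nu> =
     gls_weight N T x \<nu> * b_within N T x y + (1 - gls_weight N T x \<nu>) * b_between N T x y"

definition var_within :: "nat \<Rightarrow> nat \<Rightarrow> (nat \<Rightarrow> nat \<Rightarrow> real) \<Rightarrow> real \<Rightarrow> real" where
  "var_within N T x \<sigma> = \<sigma>\<^sup>2 / SSW N T x"

definition var_between :: "nat \<Rightarrow> nat \<Rightarrow> (nat \<Rightarrow> nat \<Rightarrow> real) \<Rightarrow> real \<Rightarrow> real \<Rightarrow> real" where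
  "var_between N T x \<sigma> \<nu> = \<sigma>\<^sup>2 * qf \<nu> T / SSB N T x"

definition var_gls :: "nat \<Rightarrow> nat \<Rightarrow> (nat \<Rightarrow> nat \<Rightarrow> real) \<Rightarrow> real \<Rightarrow> real \<Rightarrow> real" where
  "var_gls N T x \<sigma> \<nu> = \<sigma>\<^sup>2 * gls_weight N T x \<nu> / SSW N T x"

definition sigma2_eps_hat ::
  "nat \<Rightarrow> nat \<Rightarrow> (nat \<Rightarrow> nat \<Rightarrow> real) \<Rightarrow> (nat \<Rightarrow> nat \<Rightarrow> real) \<Rightarrow> real" where
  "sigma2_eps_hat N T x y =
     (\<Sum>i\<in>{1..N}. \<Sum>t\<in>{1..T}.
        ((y i t - time_mean T y i) - b_within N T x y * (x i t - time_mean T x i))\<^sup>2)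
       / (real N * (real T - 1))"

definition a_between ::
  "nat \<Rightarrow> nat \<Rightarrow> (nat \<Rightarrow> nat \<Rightarrow> real) \<Rightarrow> (nat \<Rightarrow> nat \<Rightarrow> real) \<Rightarrow> real" where
  "a_between N T x y = grand_mean N T y - b_between N T x y * grand_mean N T x"

text \<open>
  The following estimate of \<open>\<sigma>\<^sub>\<eta>\<^sup>2\<close>, and hence \<open>nu_hat\<close>, may be negative; it is not truncated at
  \<open>0\<close>. If \<^term>\<open>sigma2_eps_hat N T x y > 0\<close>, then \<^term>\<open>qf (nu_hat N T x y) T\<close> is the residual
  mean square of the between regression divided by \<^term>\<open>sigma2_eps_hat N T x y\<close>, hence
  nonnegative, so the square roots in the intervals below are taken of nonnegative numbers.
\<close>

definition sigma2_eta_hat ::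
  "nat \<Rightarrow> nat \<Rightarrow> (nat \<Rightarrow> nat \<Rightarrow> real) \<Rightarrow> (nat \<Rightarrow> nat \<Rightarrow> real) \<Rightarrow> real" where
  "sigma2_eta_hat N T x y =
     (\<Sum>i\<in>{1..N}.
        (time_mean T y i - (a_between N T x y + b_between N T x y * time_mean T x i))\<^sup>2) / real N
       - sigma2_eps_hat N T x y / real T"

definition sigma_eps_hat ::
  "nat \<Rightarrow> nat \<Rightarrow> (nat \<Rightarrow> nat \<Rightarrow> real) \<Rightarrow> (nat \<Rightarrow> nat \<Rightarrow> real) \<Rightarrow> real" where
  "sigma_eps_hat N T x y = sqrt (sigma2_eps_hat N T x y)"

definition nu_hat ::
  "nat \<Rightarrow> nat \<Rightarrow> (nat \<Rightarrow> nat \<Rightarrow> real) \<Rightarrow> (nat \<Rightarrow> nat \<Rightarrow> real) \<Rightarrow> real" where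
  "nu_hat N T x y = sigma2_eta_hat N T x y / sigma2_eps_hat N T x y"

definition normal_quantile :: "real \<Rightarrow> real" where
  "normal_quantile c = inv (cdf std_normal_distribution) c"

definition ci_gls ::
  "nat \<Rightarrow> nat \<Rightarrow> (nat \<Rightarrow> nat \<Rightarrow> real) \<Rightarrow> (nat \<Rightarrow> nat \<Rightarrow> real) \<Rightarrow> real \<Rightarrow> real \<Rightarrow> real \<Rightarrow> real set" where
  "ci_gls N T x y \<alpha> \<sigma> \<nu> =
     {b_gls N T x y \<nu> - normal_quantile (1 - \<alpha> / 2) * sqrt (var_gls N T x \<sigma> \<nu>) ..
      b_gls N T x y \<nu> + normal_quantile (1 - \<alpha> / 2) * sqrt (var_gls N T x \<sigma> \<nu>)}"

definition ci_within ::
  "nat \<Rightarrow> nat \<Rightarrow> (nat \<Rightarrow> nat \<Rightarrow> real) \<Rightarrow> (nat \<Rightarrow> nat \<Rightarrow> real) \<Rightarrow> real \<Rightarrow> real \<Rightarrow> real set" where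
  "ci_within N T x y \<alpha> \<sigma> =
     {b_within N T x y - normal_quantile (1 - \<alpha> / 2) * sqrt (var_within N T x \<sigma>) ..
      b_within N T x y + normal_quantile (1 - \<alpha> / 2) * sqrt (var_within N T x \<sigma>)}"

definition hausman_stat ::
  "nat \<Rightarrow> nat \<Rightarrow> (nat \<Rightarrow> nat \<Rightarrow> real) \<Rightarrow> (nat \<Rightarrow> nat \<Rightarrow> real) \<Rightarrow> real \<Rightarrow> real \<Rightarrow> real" where
  "hausman_stat N T x y \<sigma> \<nu> =
     (b_within N T x y - b_between N T x y)\<^sup>2 / (var_within N T x \<sigma> + var_between N T x \<sigma> \<nu>)"

definition ci_two_stage ::
  "nat \<Rightarrow> nat \<Rightarrow> (nat \<Rightarrow> nat \<Rightarrow> real) \<Rightarrow> (nat \<Rightarrow> nat \<Rightarrow> real) \<Rightarrow> real \<Rightarrow> real \<Rightarrow> real \<Rightarrow> real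
    \<Rightarrow> real set" where
  "ci_two_stage N T x y \<alpha> \<alpha>\<^sub>H \<sigma> \<nu> =
     (if hausman_stat N T x y \<sigma> \<nu> \<le> (normal_quantile (1 - \<alpha>\<^sub>H / 2))\<^sup>2
      then ci_gls N T x y \<alpha> \<sigma> \<nu> else ci_within N T x y \<alpha> \<sigma>)"

definition ci_two_stage_hat ::
  "nat \<Rightarrow> nat \<Rightarrow> (nat \<Rightarrow> nat \<Rightarrow> real) \<Rightarrow> (nat \<Rightarrow> nat \<Rightarrow> real) \<Rightarrow> real \<Rightarrow> real \<Rightarrow> real set" where
  "ci_two_stage_hat N T x y \<alpha> \<alpha>\<^sub>H =
     ci_two_stage N T x y \<alpha> \<alpha>\<^sub>H (sigma_eps_hat N T x y) (nu_hat N T x y)"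

end

theory Submission
  imports Defs
begin

text \<open>
  The interval is equivariant under affine changes \<open>c y + d + m x\<close> of the response, \<open>c \<noteq> 0\<close>. Hence
  \<open>b\<close> is covered for \<open>y\<close> iff \<open>0\<close> is covered for the standardised response, whose mean is
  \<open>\<gamma> N\<^sup>-\<^sup>1\<^sup>/\<^sup>2\<close> times the time mean of \<open>x\<close> and whose noise is a fixed linear function of independent
  standard normal variables. Negating the response does not change whether \<open>0\<close> is covered, and
  replaces \<open>\<gamma>\<close> by \<open>-\<gamma>\<close> and the noise by its negative, which has the same law.
\<close>

section \<open>Equivariance of the estimators and intervals under affine changes of the
  response\<close>

context
  fixes N T :: nat and x y y' :: "nat \<Rightarrow> nat \<Rightarrow> real" and c d m :: real
  assumes N: "N > 0" and T: "T > 0"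
    and SSB: "SSB N T x > 0" and SSW: "SSW N T x > 0"
    and c: "c \<noteq> 0"
    and affine: "\<And>i t. i \<in> {1..N} \<Longrightarrow> t \<in> {1..T} \<Longrightarrow> y' i t = c * y i t + d + m * x i t"
begin

lemma time_mean_affine:
  assumes "i \<in> {1..N}"
  shows "time_mean T y' i = c * time_mean T y i + d + m * time_mean T x i"
proof -
  have "(\<Sum>t\<in>{1..T}. y' i t) = (\<Sum>t\<in>{1..T}. c * y i t + d + m * x i t)"
    using affine assms by (intro sum.cong) auto
  then show ?thesis
    using T by (simp add: time_mean_def sum.distrib flip: sum_distrib_left) (simp add: field_simps)
qed

lemma grand_mean_affine:
  "grand_mean N T y' = c * grand_mean N T y + d + m * grand_mean N T x"
proof -
  have "(\<Sum>i\<in>{1..N}. time_mean T y' i)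
      = (\<Sum>i\<in>{1..N}. c * time_mean T y i + d + m * time_mean T x i)"
    using time_mean_affine by (intro sum.cong) auto
  then show ?thesis
    using N by (simp add: grand_mean_def sum.distrib flip: sum_distrib_left) (simp add: field_simps)
qed

lemma within_deviation_affine:
  assumes "i \<in> {1..N}" "t \<in> {1..T}"
  shows "y' i t - time_mean T y' i
    = c * (y i t - time_mean T y i) + m * (x i t - time_mean T x i)"
  using affine[OF assms] time_mean_affine[OF assms(1)] by (simp add: algebra_simps)

lemma between_deviation_affine:
  assumes "i \<in> {1..N}"
  shows "time_mean T y' i - grand_mean N T y'
    = c * (time_mean T y i - grand_mean N T y) + m * (time_mean T x i - grand_mean N T x)"
  using time_mean_affine[OF assms] grand_mean_affine by (simp add: algebra_simps)

text \<open>Centring removes \<open>d\<close>, and regressing the deviations of \<open>x\<close> on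
  themselves gives slope 1, so \<open>m * x\<close> contributes exactly \<open>m\<close>. Positivity
  of \<open>SSW\<close> makes that quotient equal to 1.\<close>

lemma b_within_affine: "b_within N T x y' = c * b_within N T x y + m"
proof -
  have "(\<Sum>i\<in>{1..N}. \<Sum>t\<in>{1..T}. (x i t - time_mean T x i) * (y' i t - time_mean T y' i))
      = (\<Sum>i\<in>{1..N}. \<Sum>t\<in>{1..T}. c * ((x i t - time_mean T x i) * (y i t - time_mean T y i))
          + m * (x i t - time_mean T x i)\<^sup>2)"
    by (intro sum.cong refl, subst within_deviation_affine)
       (auto simp: algebra_simps power2_eq_square)
  also have "\<dots> = c * (\<Sum>i\<in>{1..N}. \<Sum>t\<in>{1..T}.
      (x i t - time_mean T x i) * (y i t - time_mean T y i)) + m * SSW N T x"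
    unfolding SSW_def sum.distrib sum_distrib_left ..
  finally show ?thesis
    using SSW by (simp add: b_within_def add_divide_distrib)
qed

lemma b_between_affine: "b_between N T x y' = c * b_between N T x y + m"
proof -
  have "(\<Sum>i\<in>{1..N}. (time_mean T x i - grand_mean N T x) * (time_mean T y' i - grand_mean N T y'))
      = (\<Sum>i\<in>{1..N}. c * ((time_mean T x i - grand_mean N T x) * (time_mean T y i - grand_mean N T y))
          + m * (time_mean T x i - grand_mean N T x)\<^sup>2)"
    by (intro sum.cong refl, subst between_deviation_affine)
       (auto simp: algebra_simps power2_eq_square)
  also have "\<dots> = c * (\<Sum>i\<in>{1..N}.
      (time_mean T x i - grand_mean N T x) * (time_mean T y i - grand_mean N T y)) + m * SSB N T x"
    unfolding SSB_def sum.distrib sum_distrib_left ..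
  finally show ?thesis
    using SSB by (simp add: b_between_def add_divide_distrib)
qed

text \<open>The fitted slope absorbs \<open>m\<close>, so every within residual is merely multiplied
  by \<open>c\<close>.\<close>

lemma sigma2_eps_hat_affine: "sigma2_eps_hat N T x y' = c\<^sup>2 * sigma2_eps_hat N T x y"
proof -
  have "(\<Sum>i\<in>{1..N}. \<Sum>t\<in>{1..T}.
          ((y' i t - time_mean T y' i) - b_within N T x y' * (x i t - time_mean T x i))\<^sup>2)
      = (\<Sum>i\<in>{1..N}. \<Sum>t\<in>{1..T}.
          c\<^sup>2 * ((y i t - time_mean T y i) - b_within N T x y * (x i t - time_mean T x i))\<^sup>2)"
    by (intro sum.cong refl, subst within_deviation_affine)
       (auto simp: b_within_affine algebra_simps power2_eq_square)
  then show ?thesis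
    by (simp add: sigma2_eps_hat_def flip: sum_distrib_left)
qed

text \<open>In the between regression the intercept absorbs \<open>d\<close> and the slope absorbs
  \<open>m\<close>. Both the mean squared residual and the subtracted error variance therefore scale
  by the square of \<open>c\<close>.\<close>

lemma sigma2_eta_hat_affine: "sigma2_eta_hat N T x y' = c\<^sup>2 * sigma2_eta_hat N T x y"
proof -
  have "(\<Sum>i\<in>{1..N}. (time_mean T y' i
          - (a_between N T x y' + b_between N T x y' * time_mean T x i))\<^sup>2)
      = (\<Sum>i\<in>{1..N}. c\<^sup>2 * (time_mean T y i
          - (a_between N T x y + b_between N T x y * time_mean T x i))\<^sup>2)"
    by (intro sum.cong refl)
       (simp add: a_between_def time_mean_affine grand_mean_affine b_between_affine
          algebra_simps power2_eq_square)
  then show ?thesis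
    by (simp add: sigma2_eta_hat_def sigma2_eps_hat_affine algebra_simps flip: sum_distrib_left)
qed

lemma sigma_eps_hat_affine: "sigma_eps_hat N T x y' = \<bar>c\<bar> * sigma_eps_hat N T x y"
  by (simp add: sigma_eps_hat_def sigma2_eps_hat_affine real_sqrt_mult)

text \<open>Both variance estimates carry the same nonzero factor, which cancels. If
  \<open>sigma2_eps_hat\<close> vanishes, both quotients are 0.\<close>

lemma nu_hat_affine: "nu_hat N T x y' = nu_hat N T x y"
  using c by (simp add: nu_hat_def sigma2_eps_hat_affine sigma2_eta_hat_affine)

lemma b_gls_affine: "b_gls N T x y' \<nu> = c * b_gls N T x y \<nu> + m"
  by (simp add: b_gls_def b_within_affine b_between_affine algebra_simps)

lemma var_within_scale: "var_within N T x (\<bar>c\<bar> * \<sigma>) = c\<^sup>2 * var_within N T x \<sigma>"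
  by (simp add: var_within_def power_mult_distrib)

lemma var_gls_scale: "var_gls N T x (\<bar>c\<bar> * \<sigma>) \<nu> = c\<^sup>2 * var_gls N T x \<sigma> \<nu>"
  by (simp add: var_gls_def power_mult_distrib)

text \<open>The shift \<open>m\<close> cancels in the difference of the slopes, and the squared
  difference and the variance sum then scale alike. Hence the pretest takes the same decision for
  \<open>y\<close> and \<open>y'\<close>.\<close>

lemma hausman_stat_affine: "hausman_stat N T x y' (\<bar>c\<bar> * \<sigma>) \<nu> = hausman_stat N T x y \<sigma> \<nu>"
proof -
  have "b_within N T x y' - b_between N T x y' = c * (b_within N T x y - b_between N T x y)"
    by (simp add: b_within_affine b_between_affine algebra_simps)
  moreover have "var_between N T x (\<bar>c\<bar> * \<sigma>) \<nu> = c\<^sup>2 * var_between N T x \<sigma> \<nu>"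
    by (simp add: var_between_def power_mult_distrib)
  ultimately show ?thesis
    using c by (simp add: hausman_stat_def var_within_scale power_mult_distrib flip: distrib_left)
qed

text \<open>For negative \<open>c\<close> the endpoints change places. Writing membership as a bound
  on the distance to the midpoint treats both signs at once.\<close>

lemma affine_mem_interval_iff:
  fixes \<beta> p h :: real
  shows "c * \<beta> + m \<in> {c * p + m - \<bar>c\<bar> * h .. c * p + m + \<bar>c\<bar> * h} \<longleftrightarrow> \<beta> \<in> {p - h .. p + h}"
proof -
  have "c * \<beta> + m \<in> {c * p + m - \<bar>c\<bar> * h .. c * p + m + \<bar>c\<bar> * h} \<longleftrightarrow> \<bar>c * (\<beta> - p)\<bar> \<le> \<bar>c\<bar> * h"
    unfolding abs_le_iff by (auto simp: algebra_simps)
  also have "\<dots> \<longleftrightarrow> \<bar>\<beta> - p\<bar> \<le> h"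
    using c by (simp add: abs_mult)
  finally show ?thesis
    by auto
qed

lemma ci_two_stage_hat_affine:
  "c * \<beta> + m \<in> ci_two_stage_hat N T x y' \<alpha> \<alpha>\<^sub>H \<longleftrightarrow> \<beta> \<in> ci_two_stage_hat N T x y \<alpha> \<alpha>\<^sub>H"
proof -
  \<comment> \<open>Stated for arbitrary \<sigma> and \<nu>, to be instantiated with the estimates
    from \<open>y\<close>; those from \<open>y'\<close> are \<open>\<bar>c\<bar>\<close> times the
    first and the second unchanged.\<close>
  have "c * \<beta> + m \<in> ci_gls N T x y' \<alpha> (\<bar>c\<bar> * \<sigma>) \<nu> \<longleftrightarrow> \<beta> \<in> ci_gls N T x y \<alpha> \<sigma> \<nu>" for \<sigma> \<nu>
    using affine_mem_interval_iff[of \<beta> "b_gls N T x y \<nu>"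
        "normal_quantile (1 - \<alpha> / 2) * sqrt (var_gls N T x \<sigma> \<nu>)"]
    by (simp add: ci_gls_def b_gls_affine var_gls_scale real_sqrt_mult mult.left_commute)
  moreover have "c * \<beta> + m \<in> ci_within N T x y' \<alpha> (\<bar>c\<bar> * \<sigma>) \<longleftrightarrow> \<beta> \<in> ci_within N T x y \<alpha> \<sigma>" for \<sigma>
    using affine_mem_interval_iff[of \<beta> "b_within N T x y"
        "normal_quantile (1 - \<alpha> / 2) * sqrt (var_within N T x \<sigma>)"]
    by (simp add: ci_within_def b_within_affine var_within_scale real_sqrt_mult mult.left_commute)
  ultimately show ?thesis
    by (simp add: ci_two_stage_hat_def ci_two_stage_def sigma_eps_hat_affine nu_hat_affine
        hausman_stat_affine)
qed

end

section \<open>The standardised model\<close>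

abbreviation noise_index :: "nat \<Rightarrow> nat \<Rightarrow> (nat + nat \<times> nat) set" where
  "noise_index N T \<equiv> {1..N} <+> {1..N} \<times> {1..T}"

abbreviation std_noise :: "nat \<Rightarrow> nat \<Rightarrow> (nat + nat \<times> nat \<Rightarrow> real) measure" where
  "std_noise N T \<equiv> PiM (noise_index N T) (\<lambda>_. std_normal_distribution)"

text \<open>This is the model with \<open>a = b = 0\<close>, error standard deviation 1, individual
  effects of standard deviation \<open>sqrt \<nu>\<close> and \<xi> recovered from \<gamma>.
  \<open>Inl\<close> and \<open>Inr\<close> index the two kinds of noise as in the locale assumption
  \<open>indep\<close>.\<close>

definition std_response ::
  "nat \<Rightarrow> nat \<Rightarrow> (nat \<Rightarrow> nat \<Rightarrow> real) \<Rightarrow> real \<Rightarrow> real \<Rightarrow> (nat + nat \<times> nat \<Rightarrow> real) \<Rightarrow> nat \<Rightarrow> nat \<Rightarrow> real"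
  where "std_response N T x \<nu> \<gamma> z i t =
    \<gamma> / sqrt (real N) * time_mean T x i + sqrt \<nu> * z (Inl i) + z (Inr (i, t))"

text \<open>The function of \<gamma> whose existence the theorem claims. It lives on a fixed product
  space and so refers to no particular realisation of the panel model.\<close>

definition std_coverage ::
  "nat \<Rightarrow> nat \<Rightarrow> (nat \<Rightarrow> nat \<Rightarrow> real) \<Rightarrow> real \<Rightarrow> real \<Rightarrow> real \<Rightarrow> real \<Rightarrow> real" where
  "std_coverage N T x \<alpha> \<alpha>\<^sub>H \<nu> \<gamma> = measure (std_noise N T)
    {z \<in> space (std_noise N T). 0 \<in> ci_two_stage_hat N T x (std_response N T x \<nu> \<gamma> z) \<alpha> \<alpha>\<^sub>H}"

lemma prob_space_std_normal: "prob_space std_normal_distribution"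
  using prob_space_normal_density[of 1 0] by simp

section \<open>Measurability of the coverage event\<close>

lemma std_response_measurable:
  assumes "i \<in> {1..N}" "t \<in> {1..T}"
  shows "(\<lambda>z. std_response N T x \<nu> \<gamma> z i t) \<in> borel_measurable (std_noise N T)"
proof -
  have "(\<lambda>z. z k) \<in> borel_measurable (std_noise N T)" if "k \<in> noise_index N T" for k
    using measurable_component_singleton[OF that, of "\<lambda>_. std_normal_distribution"] by simp
  then have [measurable]: "(\<lambda>z. z (Inl i)) \<in> borel_measurable (std_noise N T)"
      "(\<lambda>z. z (Inr (i, t))) \<in> borel_measurable (std_noise N T)"
    using assms by blast+
  show ?thesis
    unfolding std_response_def by measurable
qed

lemma covers_measurable:
  assumes Y: "\<And>i t. i \<in> {1..N} \<Longrightarrow> t \<in> {1..T} \<Longrightarrow> (\<lambda>z. Y z i t) \<in> borel_measurable M"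
  shows "{z \<in> space M. \<beta> \<in> ci_two_stage_hat N T x (Y z) \<alpha> \<alpha>\<^sub>H} \<in> sets M"
proof -
  \<comment> \<open>Only entries with indices in range are known to be measurable, so the rules for
    sums are applied explicitly to bring these index bounds into scope.\<close>
  have tm [measurable]: "(\<lambda>z. time_mean T (Y z) i) \<in> borel_measurable M" if "i \<in> {1..N}" for i
    unfolding time_mean_def using Y that by (intro borel_measurable_divide borel_measurable_sum) auto
  have gm [measurable]: "(\<lambda>z. grand_mean N T (Y z)) \<in> borel_measurable M"
    unfolding grand_mean_def using tm by (intro borel_measurable_divide borel_measurable_sum) auto
  have bw [measurable]: "(\<lambda>z. b_within N T x (Y z)) \<in> borel_measurable M"
    unfolding b_within_def using tm Y
    by (intro borel_measurable_divide borel_measurable_sum borel_measurable_times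
        borel_measurable_diff) auto
  have bb [measurable]: "(\<lambda>z. b_between N T x (Y z)) \<in> borel_measurable M"
    unfolding b_between_def using tm gm
    by (intro borel_measurable_divide borel_measurable_sum borel_measurable_times
        borel_measurable_diff) auto
  have se [measurable]: "(\<lambda>z. sigma2_eps_hat N T x (Y z)) \<in> borel_measurable M"
    unfolding sigma2_eps_hat_def using tm Y bw
    by (intro borel_measurable_divide borel_measurable_sum borel_measurable_times
        borel_measurable_power borel_measurable_diff) auto
  have [measurable]: "(\<lambda>z. sigma2_eta_hat N T x (Y z)) \<in> borel_measurable M"
    unfolding sigma2_eta_hat_def a_between_def using tm gm bb se
    by (intro borel_measurable_divide borel_measurable_sum borel_measurable_times
        borel_measurable_power borel_measurable_diff borel_measurable_add) auto
  \<comment> \<open>Pushing membership through the conditional and splitting intervals into two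
    inequalities leaves comparisons of measurable real functions.\<close>
  have "Measurable.pred M (\<lambda>z. \<beta> \<in> ci_two_stage_hat N T x (Y z) \<alpha> \<alpha>\<^sub>H)"
    unfolding ci_two_stage_hat_def ci_two_stage_def ci_gls_def ci_within_def hausman_stat_def
      b_gls_def var_gls_def var_within_def var_between_def gls_weight_def qf_def
      nu_hat_def sigma_eps_hat_def if_distrib[of "\<lambda>A. \<beta> \<in> A"] atLeastAtMost_iff
    by measurable
  then show ?thesis
    by (simp add: pred_def)
qed

section \<open>Reflection of the noise and evenness\<close>

lemma distr_std_normal_uminus:
  "distr std_normal_distribution std_normal_distribution uminus = std_normal_distribution"
proof -
  \<comment> \<open>The identity on the standard normal space is itself a standard normal variable,
    to which the affine rule with factor -1 applies.\<close>
  have "distributed std_normal_distribution lborel (\<lambda>z. z) (normal_density 0 1)"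
    by (simp add: distributed_def distr_id2)
  from prob_space.normal_density_affine[OF prob_space_std_normal this, of "-1" 0]
  have "distr std_normal_distribution lborel uminus = std_normal_distribution"
    by (simp add: distributed_def)
  then show ?thesis
    by (simp cong: distr_cong)
qed

lemma std_coverage_even:
  assumes "N > 0" "T > 0" "SSB N T x > 0" "SSW N T x > 0"
  shows "std_coverage N T x \<alpha> \<alpha>\<^sub>H \<nu> (- \<gamma>) = std_coverage N T x \<alpha> \<alpha>\<^sub>H \<nu> \<gamma>"
proof -
  let ?I = "noise_index N T" and ?P = "std_noise N T"
  \<comment> \<open>\<open>compose\<close> negates on the index set and stays
    \<open>undefined\<close> outside it, so the image is again a point of the product space.\<close>
  let ?neg = "compose ?I uminus :: (nat + nat \<times> nat \<Rightarrow> real) \<Rightarrow> _"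
  let ?A = "\<lambda>\<gamma>. {z \<in> space ?P. 0 \<in> ci_two_stage_hat N T x (std_response N T x \<nu> \<gamma> z) \<alpha> \<alpha>\<^sub>H}"
  have distr: "distr ?P ?P ?neg = ?P"
    using distr_PiM_finite_prob_space'[of ?I "\<lambda>_. std_normal_distribution"
        "\<lambda>_. std_normal_distribution" uminus]
    by (simp add: distr_std_normal_uminus prob_space_std_normal)
  have neg: "?neg \<in> measurable ?P ?P"
    unfolding compose_def by measurable
  \<comment> \<open>Negating both \<gamma> and the noise negates the whole response on the panel;
    equivariance with \<open>c = -1\<close> and no shift fixes the target 0.\<close>
  have "0 \<in> ci_two_stage_hat N T x (std_response N T x \<nu> (- \<gamma>) (?neg z)) \<alpha> \<alpha>\<^sub>H \<longleftrightarrow>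
      0 \<in> ci_two_stage_hat N T x (std_response N T x \<nu> \<gamma> z) \<alpha> \<alpha>\<^sub>H" for z
    using ci_two_stage_hat_affine[OF assms, of "-1" "std_response N T x \<nu> (- \<gamma>) (?neg z)"
        "std_response N T x \<nu> \<gamma> z" 0 0 0]
    by (simp add: std_response_def compose_def InlI InrI)
  then have "?neg -` ?A (- \<gamma>) \<inter> space ?P = ?A \<gamma>"
    using measurable_space[OF neg] by auto
  \<comment> \<open>The product measure is replaced by its own image under \<open>?neg\<close>,
    which turns the event into its preimage.\<close>
  moreover have "measure ?P (?A (- \<gamma>)) = measure ?P (?neg -` ?A (- \<gamma>) \<inter> space ?P)"
    by (subst distr[symmetric], rule measure_distr[OF neg])
       (rule covers_measurable, rule std_response_measurable)
  ultimately show ?thesis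
    by (simp add: std_coverage_def)
qed

section \<open>Reduction of the panel model to the standardised one\<close>

context random_effects_panel
begin

definition std_noise_of :: "'w \<Rightarrow> nat + nat \<times> nat \<Rightarrow> real" where
  "std_noise_of \<omega> = (\<lambda>k\<in>noise_index N T.
     case_sum (\<lambda>_. 1 / \<sigma>\<^sub>\<eta>) (\<lambda>_. 1 / \<sigma>\<^sub>\<epsilon>) k * case_sum \<eta> (\<lambda>(i, t). \<epsilon> i t) k \<omega>)"

text \<open>Dividing each error by its standard deviation keeps independence and makes every
  marginal standard normal, so the joint law is the product measure. \<open>N > 0\<close> makes the
  index set nonempty, as the product characterisation of independence requires.\<close>

lemma
  assumes "N > 0"
  shows distr_std_noise_of: "distr M (std_noise N T) std_noise_of = std_noise N T"
    and std_noise_of_measurable: "std_noise_of \<in> measurable M (std_noise N T)"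
proof -
  let ?I = "noise_index N T"
  define X where "X k \<omega> = case_sum (\<lambda>_. 1 / \<sigma>\<^sub>\<eta>) (\<lambda>_. 1 / \<sigma>\<^sub>\<epsilon>) k * case_sum \<eta> (\<lambda>(i, t). \<epsilon> i t) k \<omega>"
    for k \<omega>
  have X: "std_noise_of = (\<lambda>\<omega>. \<lambda>k\<in>?I. X k \<omega>)"
    by (simp add: fun_eq_iff std_noise_of_def X_def)
  have ind: "indep_vars (\<lambda>_. borel) X ?I"
    unfolding X_def
    by (rule indep_vars_compose2[OF indep]) measurable
  have X_distr: "distr M borel (X k) = std_normal_distribution" if "k \<in> ?I" for k
  proof -
    have "distributed M lborel (X k) std_normal_density"
      using that
    proof (rule PlusE)
      fix i assume "i \<in> {1..N}" "k = Inl i"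
      then show ?thesis
        using normal_density_affine[OF eta_distr sigma_eta_pos, of i "1 / \<sigma>\<^sub>\<eta>" 0] sigma_eta_pos
        by (simp add: X_def[abs_def])
    next
      fix p assume "p \<in> {1..N} \<times> {1..T}" "k = Inr p"
      then show ?thesis
        using normal_density_affine[OF eps_distr sigma_eps_pos, of "fst p" "snd p" "1 / \<sigma>\<^sub>\<epsilon>" 0]
          sigma_eps_pos
        by (auto simp: X_def[abs_def])
    qed
    then have "distr M lborel (X k) = std_normal_distribution"
      by (simp add: distributed_def)
    then show ?thesis
      by (simp cong: distr_cong)
  qed
  have rv: "X k \<in> borel_measurable M" if "k \<in> ?I" for k
    using ind that by (auto simp: indep_vars_def2)
  \<comment> \<open>This allows the target of the image measure to be changed from a product of
    Borel spaces to \<open>std_noise\<close>.\<close>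
  have sets: "sets (PiM ?I (\<lambda>_. borel)) = sets (std_noise N T)"
    by (rule sets_PiM_cong) auto
  show meas: "std_noise_of \<in> measurable M (std_noise N T)"
    unfolding X by (rule measurable_restrict) (use rv in simp)
  have "distr M (PiM ?I (\<lambda>_. borel)) std_noise_of = PiM ?I (\<lambda>k. distr M borel (X k))"
    using indep_vars_iff_distr_eq_PiM'[of ?I X "\<lambda>_. borel"] ind rv \<open>N > 0\<close> unfolding X by auto
  also have "\<dots> = std_noise N T"
    by (intro PiM_cong) (auto simp: X_distr)
  finally show "distr M (std_noise N T) std_noise_of = std_noise N T"
    using sets by (simp cong: distr_cong)
qed

lemma coverage_eq_std_coverage:
  assumes "N > 0" "T > 0" "SSB N T x > 0" "SSW N T x > 0"
  shows "measure M {\<omega> \<in> space M. b \<in> ci_two_stage_hat N T x (\<lambda>i t. y i t \<omega>) \<alpha> \<alpha>\<^sub>H}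
    = std_coverage N T x \<alpha> \<alpha>\<^sub>H (\<sigma>\<^sub>\<eta>\<^sup>2 / \<sigma>\<^sub>\<epsilon>\<^sup>2) (\<xi> * sqrt (real N) / \<sigma>\<^sub>\<epsilon>)"
proof -
  let ?P = "std_noise N T"
  let ?Y = "std_response N T x (\<sigma>\<^sub>\<eta>\<^sup>2 / \<sigma>\<^sub>\<epsilon>\<^sup>2) (\<xi> * sqrt (real N) / \<sigma>\<^sub>\<epsilon>)"
  let ?A = "{z \<in> space ?P. 0 \<in> ci_two_stage_hat N T x (?Y z) \<alpha> \<alpha>\<^sub>H}"
  have sqrt_nu: "sqrt (\<sigma>\<^sub>\<eta>\<^sup>2 / \<sigma>\<^sub>\<epsilon>\<^sup>2) = \<sigma>\<^sub>\<eta> / \<sigma>\<^sub>\<epsilon>"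
    using sigma_eps_pos sigma_eta_pos by (simp add: real_sqrt_divide)
  have y: "y i t \<omega> = \<sigma>\<^sub>\<epsilon> * ?Y (std_noise_of \<omega>) i t + a + b * x i t"
    if "\<omega> \<in> space M" "i \<in> {1..N}" "t \<in> {1..T}" for i t \<omega>
  proof -
    have "std_noise_of \<omega> (Inl i) = \<eta> i \<omega> / \<sigma>\<^sub>\<eta>" "std_noise_of \<omega> (Inr (i, t)) = \<epsilon> i t \<omega> / \<sigma>\<^sub>\<epsilon>"
      using that(2,3) by (auto simp: std_noise_of_def)
    then show ?thesis
      unfolding response[OF that(2,3,1)] std_response_def sqrt_nu
      using \<open>N > 0\<close> sigma_eps_pos sigma_eta_pos by (simp add: distrib_left)
  qed
  \<comment> \<open>Equivariance with \<open>c = \<sigma>\<^sub>\<epsilon>\<close>,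
    \<open>d = a\<close>, \<open>m = b\<close> sends the target 0 to \<open>b\<close>.\<close>
  have "b \<in> ci_two_stage_hat N T x (\<lambda>i t. y i t \<omega>) \<alpha> \<alpha>\<^sub>H \<longleftrightarrow>
      0 \<in> ci_two_stage_hat N T x (?Y (std_noise_of \<omega>)) \<alpha> \<alpha>\<^sub>H" if "\<omega> \<in> space M" for \<omega>
    using ci_two_stage_hat_affine[OF assms, of \<sigma>\<^sub>\<epsilon> "\<lambda>i t. y i t \<omega>" "?Y (std_noise_of \<omega>)" a b 0,
        OF _ y[OF that]] sigma_eps_pos
    by simp
  then have event: "{\<omega> \<in> space M. b \<in> ci_two_stage_hat N T x (\<lambda>i t. y i t \<omega>) \<alpha> \<alpha>\<^sub>H}
      = std_noise_of -` ?A \<inter> space M"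
    using measurable_space[OF std_noise_of_measurable[OF \<open>N > 0\<close>]] by auto
  have "measure (distr M ?P std_noise_of) ?A = measure M (std_noise_of -` ?A \<inter> space M)"
    by (rule measure_distr[OF std_noise_of_measurable[OF \<open>N > 0\<close>]])
       (rule covers_measurable, rule std_response_measurable)
  then show ?thesis
    unfolding event distr_std_noise_of[OF \<open>N > 0\<close>] std_coverage_def by (rule sym)
qed

end

theorem theorem2:
  fixes N T :: nat and x :: "nat \<Rightarrow> nat \<Rightarrow> real" and \<alpha> \<alpha>\<^sub>H \<nu> :: real
  assumes "N \<ge> 3" and "T \<ge> 2"
    and "SSB N T x > 0" and "SSW N T x > 0"
    and "0 < \<alpha>" and "\<alpha> < 1" and "0 < \<alpha>\<^sub>H" and "\<alpha>\<^sub>H < 1"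
    and "\<nu> > 0"
  shows "\<exists>C :: real \<Rightarrow> real.
    (\<forall>(M :: 'w measure) a b \<xi> \<sigma>\<^sub>\<epsilon> \<sigma>\<^sub>\<eta> \<eta> \<epsilon> y.
       random_effects_panel M N T x a b \<xi> \<sigma>\<^sub>\<epsilon> \<sigma>\<^sub>\<eta> \<eta> \<epsilon> y \<longrightarrow>
       \<sigma>\<^sub>\<eta>\<^sup>2 / \<sigma>\<^sub>\<epsilon>\<^sup>2 = \<nu> \<longrightarrow>
       measure M {\<omega> \<in> space M. b \<in> ci_two_stage_hat N T x (\<lambda>i t. y i t \<omega>) \<alpha> \<alpha>\<^sub>H}
         = C (\<xi> * sqrt (real N) / \<sigma>\<^sub>\<epsilon>)) \<and>
    (\<forall>\<gamma>. C (- \<gamma>) = C \<gamma>)"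
proof -
  have "N > 0" "T > 0"
    using assms(1,2) by simp_all
  note pos = this assms(3,4)
  have "measure M {\<omega> \<in> space M. b \<in> ci_two_stage_hat N T x (\<lambda>i t. y i t \<omega>) \<alpha> \<alpha>\<^sub>H}
      = std_coverage N T x \<alpha> \<alpha>\<^sub>H \<nu> (\<xi> * sqrt (real N) / \<sigma>\<^sub>\<epsilon>)"
    if "random_effects_panel M N T x a b \<xi> \<sigma>\<^sub>\<epsilon> \<sigma>\<^sub>\<eta> \<eta> \<epsilon> y" "\<sigma>\<^sub>\<eta>\<^sup>2 / \<sigma>\<^sub>\<epsilon>\<^sup>2 = \<nu>"
    for M :: "'w measure" and a b \<xi> \<sigma>\<^sub>\<epsilon> \<sigma>\<^sub>\<eta> \<eta> \<epsilon> y
    using random_effects_panel.coverage_eq_std_coverage[OF that(1) pos] unfolding that(2) .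
  \<comment> \<open>The witness depends only on \<open>N\<close>, \<open>T\<close>,
    \<open>x\<close>, the two levels and \<nu>, so one function serves all probability spaces and
    remaining parameters.\<close>
  then show ?thesis
    using std_coverage_even[OF pos] by (intro exI[of _ "std_coverage N T x \<alpha> \<alpha>\<^sub>H \<nu>"] conjI allI impI)
qed

end
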